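(* Let $N\ge 1$, let $w_1,\dots,w_N>0$, $W=\mathrm{diag}(w_1,\dots,w_N)$, and equip $\mathbb{R}^N$ with the inner product $\langle u,v\rangle_W=\sum_{j=1}^N w_j u_j v_j$. Let $A_N\in\mathbb{R}^{N\times N}$ be invertible, let $T_{\theta,N}\in\mathbb{R}^{N\times N}$ be $W$-self-adjoint and positive semidefinite (with respect to $\langle\cdot,\cdot\rangle_W$), and set $B_{\theta,N}:=A_N T_{\theta,N}A_N^{\ast}$, where $A_N^\ast$ is the $W$-adjoint of $A_N$. Write $\alpha_N:=\|A_N^{-1}\|_W^{-1}$ and $\beta_N:=\|A_N\|_W$, and order the eigenvalues (with multiplicity) of $T_{\theta,N}$ and $B_{\theta,N}$ as $\sigma_{1,N}\ge\cdots\ge\sigma_{N,N}\ge 0$ and $\mu_{1,N}\ge\cdots\ge\mu_{N,N}\ge 0$, respectively. Then $$\alpha_N^2\,\sigma_{j,N}\;\le\;\mu_{j,N}\;\le\;\beta_N^2\,\sigma_{j,N},\qquad j=1,\dots,N.$$ In particular, if for a family of such matrices $A_N$ (indexed by $N$, each with its own weights) there are constants $0<c_A\le C_A<\infty$ independent of $N$ with $\|A_N\|_W\le C_A$ and $\|A_N^{-1}\|_W\le c_A^{-1}$, then $c_A^2\,\sigma_{j,N}\le\mu_{j,N}\le C_A^2\,\sigma_{j,N}$ for all $j$, with constants independent of $N$.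
   Context: For a matrix $T\in\mathbb{R}^{N\times N}$, $T^\ast=W^{-1}T^\top W$ denotes the adjoint with respect to $\langle\cdot,\cdot\rangle_W$, and $\|T\|_W$ denotes the operator norm induced by $\|u\|_W=\langle u,u\rangle_W^{1/2}$. $W$-self-adjoint means $T^\ast=T$; positive semidefinite means $\langle u,Tu\rangle_W\ge 0$ for all $u$. *)

theory Defs
  imports
    Complex_Main
    "Jordan_Normal_Form.Char_Poly"
    "Jordan_Normal_Form.Gauss_Jordan_Elimination"
begin

text \<open>
  Square matrices of size \<open>N\<close> are elements of \<open>carrier_mat N N\<close>, and coordinates
  run over \<open>0..<N\<close>.  A family of weights is a function \<open>nat \<Rightarrow> real\<close>, of which only
  the values below the dimension matter.
\<close>

definition winner :: "(nat \<Rightarrow> real) \<Rightarrow> real vec \<Rightarrow> real vec \<Rightarrow> real" where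
  "winner w u v = (\<Sum>j<dim_vec v. w j * u $ j * v $ j)"

definition wnorm :: "(nat \<Rightarrow> real) \<Rightarrow> real vec \<Rightarrow> real" where
  "wnorm w u = sqrt (winner w u u)"

text \<open>The operator norm is a conditionally complete supremum, so it is only meaningful
  for \<open>dim_col T \<ge> 1\<close> and positive weights.\<close>

definition wopnorm :: "(nat \<Rightarrow> real) \<Rightarrow> real mat \<Rightarrow> real" where
  "wopnorm w T =
     (SUP u \<in> carrier_vec (dim_col T) - {0\<^sub>v (dim_col T)}. wnorm w (T *\<^sub>v u) / wnorm w u)"

text \<open>Only used for invertible matrices; otherwise the value is unspecified.\<close>

definition minv :: "real mat \<Rightarrow> real mat" where
  "minv A = the (mat_inverse A)"

definition wadjoint :: "(nat \<Rightarrow> real) \<Rightarrow> real mat \<Rightarrow> real mat" where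
  "wadjoint w T = minv (mat_diag (dim_col T) w) * transpose_mat T * mat_diag (dim_row T) w"

definition wself_adjoint :: "(nat \<Rightarrow> real) \<Rightarrow> real mat \<Rightarrow> bool" where
  "wself_adjoint w T \<longleftrightarrow> wadjoint w T = T"

definition wpos_semidef :: "(nat \<Rightarrow> real) \<Rightarrow> real mat \<Rightarrow> bool" where
  "wpos_semidef w T \<longleftrightarrow> (\<forall>u \<in> carrier_vec (dim_col T). 0 \<le> winner w u (T *\<^sub>v u))"

text \<open>
  The real eigenvalues in decreasing order, each repeated according to its algebraic
  multiplicity (its order as a root of the characteristic polynomial).  The list has
  length \<open>dim_row T\<close> iff the characteristic polynomial splits over the reals.
\<close>

definition eigvals_desc :: "real mat \<Rightarrow> real list" where
  "eigvals_desc T = rev (sorted_list_of_multiset (proots (char_poly T)))"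

text \<open>The \<open>j\<close>-th largest eigenvalue, with \<open>j\<close> counted from 1.\<close>

definition eigval_desc :: "real mat \<Rightarrow> nat \<Rightarrow> real" where
  "eigval_desc T j = eigvals_desc T ! (j - 1)"

end

theory Submission
  imports Defs "HOL-Analysis.L2_Norm" "HOL-Combinatorics.List_Permutation"
begin

text \<open>
  Conjugating by \<open>W\<^bsup>1/2\<^esup>\<close> preserves spectra and turns the \<open>W\<close>-adjoint into the transpose, so
  one may work with symmetric matrices \<open>B = A T A\<^sup>T\<close> in the standard inner product.  In orthonormal
  eigenbases this reads \<open>E = G\<^sup>T D G\<close> with \<open>E\<close>, \<open>D\<close> diagonal and decreasing and
  \<open>|G c| \<le> \<parallel>A\<parallel> |c|\<close>.  A nonzero \<open>c\<close> in the span of the first \<open>j\<close> basis vectors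
  for which the first \<open>j - 1\<close> coordinates of \<open>G c\<close> vanish gives
  \<open>\<mu>\<^sub>j |c|\<^sup>2 \<le> c \<bullet> E c = G c \<bullet> D (G c) \<le> \<sigma>\<^sub>j \<parallel>A\<parallel>\<^sup>2 |c|\<^sup>2\<close>.
  The lower bound is the upper bound for \<open>T = A\<^sup>-\<^sup>1 B (A\<^sup>-\<^sup>1)\<^sup>T\<close>.
\<close>

subsection \<open>Spectral theorem for real symmetric matrices\<close>

lemma conjugate_mult_real_mat_vec:
  fixes S :: "real mat"
  assumes "S \<in> carrier_mat n n" "w \<in> carrier_vec n"
  shows "conjugate (map_mat complex_of_real S *\<^sub>v w) = map_mat complex_of_real S *\<^sub>v conjugate w"
  using assms by (intro eq_vecI) (auto simp: scalar_prod_def)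

text \<open>The characteristic polynomial splits over the complex numbers, so a complex eigenvalue
  \<open>a\<close> exists. Symmetry and real entries give \<open>a = cnj a\<close>, so
  \<open>a\<close> is real and already a root of \<open>char_poly S\<close>.\<close>

lemma symmetric_mat_unit_eigenvector:
  fixes S :: "real mat"
  assumes S: "S \<in> carrier_mat n n" and sym: "S\<^sup>T = S" and n: "0 < n"
  obtains v e where "v \<in> carrier_vec n" "v \<bullet> v = 1" "S *\<^sub>v v = e \<cdot>\<^sub>v v"
proof -
  define C where "C = map_mat complex_of_real S"
  have C: "C \<in> carrier_mat n n" using S by (simp add: C_def)
  have "C\<^sup>T = map_mat complex_of_real (S\<^sup>T)" by (rule eq_matI) (auto simp: C_def)
  then have Ct: "C\<^sup>T = C" by (simp add: sym C_def)
  obtain as where as: "char_poly C = (\<Prod>a\<leftarrow>as. [:- a, 1:])" "length as = n"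
    using char_poly_factorized[OF C] by blast
  obtain a where a: "a \<in> set as" using as(2) n by (cases as) auto
  have "poly (char_poly C) a = 0"
    unfolding as(1) using a by (auto simp: poly_prod_list prod_list_zero_iff)
  then obtain w where w: "w \<in> carrier_vec n" "w \<noteq> 0\<^sub>v n" "C *\<^sub>v w = a \<cdot>\<^sub>v w"
    using eigenvalue_root_char_poly[OF C] C unfolding eigenvalue_def eigenvector_def by auto
  have cw: "conjugate w \<in> carrier_vec n" using w by simp
  \<comment> \<open>Moving the symmetric \<open>C\<close> across the sesquilinear product turns
    \<open>a\<close> into \<open>cnj a\<close>, because \<open>C\<close> commutes with conjugation
    of vectors.\<close>
  have "a * (w \<bullet>c w) = (C\<^sup>T *\<^sub>v w) \<bullet>c w" using w cw by (simp add: Ct)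
  also have "\<dots> = w \<bullet> (C *\<^sub>v conjugate w)"
    by (rule transpose_vec_mult_scalar[OF C cw w(1)])
  also have "C *\<^sub>v conjugate w = conjugate (C *\<^sub>v w)"
    unfolding C_def using conjugate_mult_real_mat_vec[OF S w(1)] by simp
  also have "w \<bullet> \<dots> = cnj a * (w \<bullet>c w)" using w cw by (simp add: conjugate_smult_vec)
  finally have "a = cnj a" using w by (simp add: conjugate_square_eq_0_vec)
  then have "a = complex_of_real (Re a)" by (simp add: complex_eq_iff)
  with \<open>poly (char_poly C) a = 0\<close> have "poly (char_poly S) (Re a) = 0"
    unfolding C_def of_real_hom.char_poly_hom[OF S]
    by (metis of_real_hom.poly_map_poly of_real_eq_0_iff)
  \<comment> \<open>A real eigenvector comes afresh from the real root; it is not extracted from the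
    complex vector \<open>w\<close>.\<close>
  then obtain u where u: "u \<in> carrier_vec n" "u \<noteq> 0\<^sub>v n" "S *\<^sub>v u = Re a \<cdot>\<^sub>v u"
    using eigenvalue_root_char_poly[OF S] S unfolding eigenvalue_def eigenvector_def by auto
  have pos: "u \<bullet> u > 0" using conjugate_square_greater_0_vec[OF u(1)] u(2) by simp
  define v where "v = (1 / sqrt (u \<bullet> u)) \<cdot>\<^sub>v u"
  show ?thesis
  proof
    show "v \<in> carrier_vec n" using u by (simp add: v_def)
    show "v \<bullet> v = 1" using u pos by (simp add: v_def)
    show "S *\<^sub>v v = Re a \<cdot>\<^sub>v v"
      unfolding v_def mult_mat_vec[OF S u(1)] u(3) by (simp add: smult_smult_assoc mult.commute)
  qed
qed

text \<open>The witness is the Householder reflection exchanging \<open>v\<close> and the first unit vector.\<close>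

lemma orthogonal_symmetric_mat_first_col:
  fixes v :: "real vec"
  assumes v: "v \<in> carrier_vec n" "v \<bullet> v = 1" and n: "0 < n"
  obtains H where "H \<in> carrier_mat n n" "H\<^sup>T = H" "H * H = 1\<^sub>m n" "H *\<^sub>v unit_vec n 0 = v"
proof (cases "v = unit_vec n 0")
  case True
  show ?thesis by (rule that[of "1\<^sub>m n"]) (use True in auto)
next
  case False
  define x where "x = v - unit_vec n 0"
  \<comment> \<open>Since \<open>v\<close> has norm 1, \<open>x \<bullet> x = 2 - 2 * v $ 0\<close>.
    Hence \<open>a = 2 / (x \<bullet> x)\<close>, the coefficient that makes
    \<open>1 - a x x^T\<close> a reflection.\<close>
  define a where "a = 1 / (1 - v $ 0)"
  define H where "H = mat n n (\<lambda>(i, j). (if i = j then 1 else 0) - a * x $ i * x $ j)"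
  have x: "x \<in> carrier_vec n" using v by (simp add: x_def)
  have vv: "(\<Sum>i\<in>{0..<n}. v $ i * v $ i) = 1"
    using v by (simp add: scalar_prod_def)
  \<comment> \<open>If the first coordinate were 1, the other squares would sum to 0 and
    \<open>v\<close> would be the first unit vector. This makes the denominator of \<open>a\<close>
    nonzero.\<close>
  have v0: "v $ 0 \<noteq> 1"
  proof
    assume v0: "v $ 0 = 1"
    have "(\<Sum>i\<in>{0..<n} - {0}. v $ i * v $ i) = 0"
      using vv n v0 by (subst (asm) sum.remove[of _ 0]) auto
    then have z: "\<forall>i\<in>{0..<n} - {0}. v $ i * v $ i = 0"
      by (subst (asm) sum_nonneg_eq_0_iff) auto
    have "v = unit_vec n 0"
      by (rule eq_vecI) (use z v v0 n in \<open>auto simp: unit_vec_def\<close>)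
    with False show False by simp
  qed
  have xi: "x $ i = v $ i - (if i = 0 then 1 else 0)" if "i < n" for i
    using that v by (auto simp: x_def unit_vec_def)
  have "x \<bullet> x = (\<Sum>i\<in>{0..<n}. x $ i * x $ i)" using x by (simp add: scalar_prod_def)
  also have "\<dots> = (\<Sum>i\<in>{0..<n}. v $ i * v $ i + (if i = 0 then 1 - 2 * v $ 0 else 0))"
    by (rule sum.cong) (auto simp: xi algebra_simps)
  also have "\<dots> = 2 - 2 * v $ 0" using n vv by (simp add: sum.distrib)
  finally have "x \<bullet> x = 2 - 2 * v $ 0" .
  then have axx: "a * (x \<bullet> x) = 2" using v0 by (simp add: a_def field_simps)
  have H: "H \<in> carrier_mat n n" by (simp add: H_def)
  have HH: "H * H = 1\<^sub>m n"
  proof (rule eq_matI)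
    fix i j assume "i < dim_row (1\<^sub>m n :: real mat)" "j < dim_col (1\<^sub>m n :: real mat)"
    then have ij: "i < n" "j < n" by auto
    have "(H * H) $$ (i, j) = (\<Sum>k\<in>{0..<n}. ((if i = k then 1 else 0) - a * x $ i * x $ k)
        * ((if k = j then 1 else 0) - a * x $ k * x $ j))"
      using ij by (simp add: H_def scalar_prod_def)
    also have "\<dots> = (\<Sum>k\<in>{0..<n}. (if i = k then (if i = j then 1 else 0) - a * x $ i * x $ j else 0)
        + (if k = j then - a * x $ i * x $ j else 0) + a * a * x $ i * x $ j * (x $ k * x $ k))"
      by (rule sum.cong) (auto simp: algebra_simps)
    also have "\<dots> = (if i = j then 1 else 0) - 2 * a * x $ i * x $ j
        + a * a * x $ i * x $ j * (x \<bullet> x)"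
      using ij x by (simp add: sum.distrib sum_distrib_left[symmetric] scalar_prod_def)
    also have "a * a * x $ i * x $ j * (x \<bullet> x) = a * x $ i * x $ j * (a * (x \<bullet> x))" by simp
    finally show "(H * H) $$ (i, j) = 1\<^sub>m n $$ (i, j)" using ij by (simp add: axx)
  qed (use H in auto)
  show ?thesis
  proof
    show "H \<in> carrier_mat n n" by (fact H)
    show "H\<^sup>T = H" by (rule eq_matI) (auto simp: H_def)
    show "H * H = 1\<^sub>m n" by (fact HH)
    show "H *\<^sub>v unit_vec n 0 = v"
    proof (rule eq_vecI)
      fix i assume "i < dim_vec v"
      then have i: "i < n" using v by simp
      have "(H *\<^sub>v unit_vec n 0) $ i = H $$ (i, 0)" using H i n by simp
      also have "\<dots> = v $ i"
        using i n v0 by (auto simp: H_def xi a_def field_simps)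
      finally show "(H *\<^sub>v unit_vec n 0) $ i = v $ i" .
    qed (use H v in auto)
  qed
qed

text \<open>Induction by deflation: a reflection \<open>H\<close> takes the first unit vector to a
  unit eigenvector, so \<open>H * S * H\<close> splits off a 1 by 1 block and the hypothesis applies
  to the remaining symmetric block.\<close>

lemma symmetric_mat_orthogonal_diagonalization:
  fixes S :: "real mat"
  assumes "S \<in> carrier_mat n n" "S\<^sup>T = S"
  shows "\<exists>U d. U \<in> carrier_mat n n \<and> U\<^sup>T * U = 1\<^sub>m n \<and> S = U * mat_diag n d * U\<^sup>T"
  using assms
proof (induction n arbitrary: S)
  case 0
  then show ?case by (intro exI[of _ "1\<^sub>m 0"]) (auto intro!: eq_matI)
next
  case (Suc m)
  note S = Suc.prems(1)
  obtain v e where v: "v \<in> carrier_vec (Suc m)" "v \<bullet> v = 1" "S *\<^sub>v v = e \<cdot>\<^sub>v v"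
    using symmetric_mat_unit_eigenvector[OF Suc.prems] by blast
  obtain H where H: "H \<in> carrier_mat (Suc m) (Suc m)" "H\<^sup>T = H" "H * H = 1\<^sub>m (Suc m)"
      "H *\<^sub>v unit_vec (Suc m) 0 = v"
    using orthogonal_symmetric_mat_first_col[OF v(1,2)] by blast
  define R where "R = H * S * H"
  have R: "R \<in> carrier_mat (Suc m) (Suc m)" using H S by (simp add: R_def)
  have Rt: "R\<^sup>T = R"
    unfolding R_def using H S Suc.prems(2)
    by (simp add: transpose_mult[of _ "Suc m" "Suc m" _ "Suc m"] assoc_mult_mat[of _ "Suc m" "Suc m" _ "Suc m" _ "Suc m"])
  have "R *\<^sub>v unit_vec (Suc m) 0 = H *\<^sub>v (S *\<^sub>v v)"
    unfolding R_def using H S by (simp add: assoc_mult_mat_vec[of _ "Suc m" "Suc m" _ "Suc m"])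
  also have "\<dots> = e \<cdot>\<^sub>v (H *\<^sub>v (H *\<^sub>v unit_vec (Suc m) 0))"
    unfolding v(3) H(4) using mult_mat_vec[OF H(1) v(1)] by simp
  also have "H *\<^sub>v (H *\<^sub>v unit_vec (Suc m) 0) = unit_vec (Suc m) 0"
    using H(1) by (subst assoc_mult_mat_vec[symmetric, of _ "Suc m" "Suc m" _ "Suc m"]) (auto simp: H(3))
  finally have R0: "R *\<^sub>v unit_vec (Suc m) 0 = e \<cdot>\<^sub>v unit_vec (Suc m) 0" .
  have col: "R $$ (i, 0) = (if i = 0 then e else 0)" if "i < Suc m" for i
    using arg_cong[OF R0, of "\<lambda>u. u $ i"] that R by auto
  \<comment> \<open>Symmetry of \<open>R\<close> carries the zeros of the first column over to the
    first row.\<close>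
  have row: "R $$ (0, j) = (if j = 0 then e else 0)" if "j < Suc m" for j
    using col[OF that] that R Rt by (metis carrier_matD index_transpose_mat(1) zero_less_Suc)
  define S2 where "S2 = mat m m (\<lambda>(i, j). R $$ (Suc i, Suc j))"
  define E where "E = mat 1 1 (\<lambda>_. e)"
  have S2: "S2 \<in> carrier_mat m m" and E: "E \<in> carrier_mat 1 1" by (auto simp: S2_def E_def)
  have "S2\<^sup>T = S2"
  proof (rule eq_matI)
    fix i j assume "i < dim_row S2" "j < dim_col S2"
    then show "S2\<^sup>T $$ (i, j) = S2 $$ (i, j)"
      using R Rt by (simp add: S2_def) (metis Suc_less_eq carrier_matD index_transpose_mat(1))
  qed (use S2 in auto)
  with Suc.IH[OF S2] obtain V d where V: "V \<in> carrier_mat m m" "V\<^sup>T * V = 1\<^sub>m m"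
      "S2 = V * mat_diag m d * V\<^sup>T" by blast
  \<comment> \<open>\<open>F\<close> extends the smaller orthogonal matrix \<open>V\<close> by a 1
    in the corner; the orthogonal matrix that diagonalizes \<open>S\<close> is then
    \<open>H * F\<close>.\<close>
  define F where "F = four_block_mat (1\<^sub>m 1) (0\<^sub>m 1 m) (0\<^sub>m m 1) V"
  define D where "D = mat_diag (Suc m) (\<lambda>i. case i of 0 \<Rightarrow> e | Suc k \<Rightarrow> d k)"
  have F: "F \<in> carrier_mat (Suc m) (Suc m)"
    using V four_block_carrier_mat[of "1\<^sub>m 1" 1 1 V m m] by (simp add: F_def)
  have D: "D \<in> carrier_mat (Suc m) (Suc m)" by (simp add: D_def)
  have Ft: "F\<^sup>T = four_block_mat (1\<^sub>m 1) (0\<^sub>m 1 m) (0\<^sub>m m 1) V\<^sup>T"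
    unfolding F_def using V by (subst transpose_four_block_mat) auto
  have FF: "F\<^sup>T * F = 1\<^sub>m (Suc m)"
    unfolding Ft unfolding F_def using V four_block_one_mat[of 1 m, where 'a = real]
    by (subst mult_four_block_mat[of _ 1 1 _ m _ m _ _ 1 _ m]) auto
  have Dblock: "D = four_block_mat E (0\<^sub>m 1 m) (0\<^sub>m m 1) (mat_diag m d)"
    by (rule eq_matI) (auto simp: D_def E_def mat_diag_def split: nat.split)
  have Rblock: "R = four_block_mat E (0\<^sub>m 1 m) (0\<^sub>m m 1) S2"
    by (rule eq_matI) (use R col row in \<open>auto simp: E_def S2_def\<close>)
  have FD: "F * D = four_block_mat E (0\<^sub>m 1 m) (0\<^sub>m m 1) (V * mat_diag m d)"
    unfolding F_def Dblock using V E left_mult_zero_mat[OF mat_diag_dim[of m d], of 1]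
    by (subst mult_four_block_mat[of _ 1 1 _ m _ m _ _ 1 _ m]) auto
  have VD: "V * mat_diag m d \<in> carrier_mat m m" using V(1) by (meson mat_diag_dim mult_carrier_mat)
  have VDV: "V * mat_diag m d * V\<^sup>T \<in> carrier_mat m m"
    by (rule mult_carrier_mat[OF VD]) (use V(1) in simp)
  have FDF: "R = F * D * F\<^sup>T"
    unfolding FD Ft Rblock V(3)
    using V(1) E VD right_mult_zero_mat[OF VD, of 1] left_add_zero_mat[OF VDV]
    by (subst mult_four_block_mat[of _ 1 1 _ m _ m _ _ 1 _ m]) auto
  have "S = H * H * S * (H * H)" using H(3) S by simp
  also have "\<dots> = H * R * H"
    unfolding R_def using H(1) S by (simp add: assoc_mult_mat[of _ "Suc m" "Suc m" _ "Suc m" _ "Suc m"])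
  also have "\<dots> = (H * F) * D * (H * F)\<^sup>T"
    unfolding FDF using H(1,2) F D
    by (simp add: transpose_mult[of _ "Suc m" "Suc m" _ "Suc m"] assoc_mult_mat[of _ "Suc m" "Suc m" _ "Suc m" _ "Suc m"])
  finally have "S = (H * F) * D * (H * F)\<^sup>T" .
  moreover have "(H * F)\<^sup>T * (H * F) = F\<^sup>T * (H * H) * F"
    using H(1,2) F
    by (simp add: transpose_mult[of _ "Suc m" "Suc m" _ "Suc m"] assoc_mult_mat[of _ "Suc m" "Suc m" _ "Suc m" _ "Suc m"])
  then have "(H * F)\<^sup>T * (H * F) = 1\<^sub>m (Suc m)" using H(3) F FF by simp
  moreover have "H * F \<in> carrier_mat (Suc m) (Suc m)" using H(1) F by simp
  ultimately show ?case unfolding D_def by blast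
qed

section \<open>Characteristic polynomials and decreasingly ordered spectra\<close>

lemma char_poly_conj:
  fixes S :: "'a :: comm_ring_1 mat"
  assumes "S \<in> carrier_mat n n" "P \<in> carrier_mat n n" "Q \<in> carrier_mat n n"
    and "P * Q = 1\<^sub>m n" "Q * P = 1\<^sub>m n"
  shows "char_poly (P * S * Q) = char_poly S"
  using assms
  by (intro char_poly_similar similar_matI[of _ _ P Q n]) auto

lemma sum_list_singleton_mset: "(\<Sum>i\<leftarrow>xs. {#f i#}) = mset (map f xs)"
  by (induction xs) auto

lemma proots_char_poly_mat_diag:
  "proots (char_poly (mat_diag n d)) = mset (map d [0..<n])"
proof -
  have "upper_triangular (mat_diag n d)" by (auto simp: mat_diag_def)
  then have "char_poly (mat_diag n d) = (\<Prod>a\<leftarrow>diag_mat (mat_diag n d). [:- a, 1:])"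
    by (intro char_poly_upper_triangular[of _ n]) auto
  also have "diag_mat (mat_diag n d) = map d [0..<n]"
    by (auto simp: diag_mat_def mat_diag_def)
  finally have eq: "char_poly (mat_diag n d) = (\<Prod>p\<leftarrow>map (\<lambda>i. [:- d i, 1:]) [0..<n]. p)"
    by (simp add: o_def)
  show ?thesis
    unfolding eq by (subst proots_prod_list) (auto simp: o_def sum_list_singleton_mset)
qed

lemma quadratic_form_mat_diag:
  fixes c :: "'a :: comm_semiring_1 vec"
  assumes "c \<in> carrier_vec n"
  shows "c \<bullet> (mat_diag n e *\<^sub>v c) = (\<Sum>i<n. e i * (c $ i)\<^sup>2)"
proof -
  have "(mat_diag n e *\<^sub>v c) $ i = e i * c $ i" if "i < n" for i
    using that assms
    by (simp add: mat_diag_def scalar_prod_def) (subst sum.remove[of _ i], auto)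
  moreover have "mat_diag n e *\<^sub>v c \<in> carrier_vec n" using assms by (meson mat_diag_dim mult_mat_vec_carrier)
  ultimately show ?thesis
    unfolding scalar_prod_def
    by (intro sum.cong) (auto simp: power2_eq_square algebra_simps simp del: index_mult_mat_vec dim_mult_mat_vec)
qed

lemma mult_mat_diag_mult_transpose_index:
  fixes U :: "'a :: comm_semiring_1 mat"
  assumes "U \<in> carrier_mat n n" "i < n" "k < n"
  shows "(U * mat_diag n d * U\<^sup>T) $$ (i, k) = (\<Sum>j<n. U $$ (i, j) * d j * U $$ (k, j))"
  using assms by (simp add: mat_diag_mult_right[of _ n] scalar_prod_def atLeast0LessThan)

text \<open>A diagonalization lists the eigenvalues in arbitrary order. Similarity shows that they
  form the same multiset as \<open>eigvals_desc S\<close>, and permuting the columns of the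
  orthogonal matrix puts them in decreasing order.\<close>

lemma symmetric_mat_spectral_desc:
  fixes S :: "real mat"
  assumes S: "S \<in> carrier_mat n n" and sym: "S\<^sup>T = S"
  obtains U where "U \<in> carrier_mat n n" "U\<^sup>T * U = 1\<^sub>m n"
    "S = U * mat_diag n (\<lambda>i. eigvals_desc S ! i) * U\<^sup>T" "length (eigvals_desc S) = n"
proof -
  obtain V d where V: "V \<in> carrier_mat n n" "V\<^sup>T * V = 1\<^sub>m n" and SV: "S = V * mat_diag n d * V\<^sup>T"
    using symmetric_mat_orthogonal_diagonalization[OF S sym] by blast
  have VV: "V * V\<^sup>T = 1\<^sub>m n" using mat_mult_left_right_inverse[OF _ V(1,2)] V(1) by simp
  define es where "es = eigvals_desc S"
  have "char_poly S = char_poly (mat_diag n d)"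
    unfolding SV using V VV by (intro char_poly_conj) auto
  then have "mset es = mset (map d [0..<n])"
    using proots_char_poly_mat_diag[of n d] by (simp add: es_def eigvals_desc_def)
  moreover from mset_eq_length[OF this] have len: "length es = n" by simp
  \<comment> \<open>Lists with equal multisets differ by a bijection \<open>f\<close> of their
    indices; it also selects the columns of \<open>V\<close> below.\<close>
  ultimately obtain f where f: "bij_betw f {..<n} {..<n}" "\<And>i. i < n \<Longrightarrow> es ! i = map d [0..<n] ! f i"
    using permutation_Ex_bij[of es "map d [0..<n]"] by auto
  have fn: "f i < n" if "i < n" for i using f(1) that by (auto simp: bij_betw_def)
  have fd: "es ! i = d (f i)" if "i < n" for i using f(2)[OF that] fn[OF that] by simp
  define U where "U = mat n n (\<lambda>(i, j). V $$ (i, f j))"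
  have U: "U \<in> carrier_mat n n" by (simp add: U_def)
  show ?thesis
  proof
    show "U \<in> carrier_mat n n" by (fact U)
    show "U\<^sup>T * U = 1\<^sub>m n"
    proof (rule eq_matI)
      fix i j assume "i < dim_row (1\<^sub>m n :: real mat)" "j < dim_col (1\<^sub>m n :: real mat)"
      then have ij: "i < n" "j < n" by auto
      have "(U\<^sup>T * U) $$ (i, j) = (V\<^sup>T * V) $$ (f i, f j)"
        using ij fn V(1) by (simp add: U_def scalar_prod_def)
      also have "\<dots> = 1\<^sub>m n $$ (i, j)"
        using ij fn f(1) by (auto simp: V(2) bij_betw_def inj_on_def)
      finally show "(U\<^sup>T * U) $$ (i, j) = 1\<^sub>m n $$ (i, j)" .
    qed (use U in auto)
    show "S = U * mat_diag n (\<lambda>i. eigvals_desc S ! i) * U\<^sup>T"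
    proof (rule eq_matI)
      fix i k
      assume "i < dim_row (U * mat_diag n (\<lambda>i. eigvals_desc S ! i) * U\<^sup>T)"
        "k < dim_col (U * mat_diag n (\<lambda>i. eigvals_desc S ! i) * U\<^sup>T)"
      then have ik: "i < n" "k < n" using U by auto
      have "S $$ (i, k) = (\<Sum>j<n. V $$ (i, j) * d j * V $$ (k, j))"
        unfolding SV using mult_mat_diag_mult_transpose_index[OF V(1) ik] .
      also have "\<dots> = (\<Sum>j<n. V $$ (i, f j) * d (f j) * V $$ (k, f j))"
        by (rule sum.reindex_bij_betw[OF f(1), symmetric])
      also have "\<dots> = (\<Sum>j<n. U $$ (i, j) * es ! j * U $$ (k, j))"
        using ik by (simp add: U_def fd)
      finally show "S $$ (i, k) = (U * mat_diag n (\<lambda>i. eigvals_desc S ! i) * U\<^sup>T) $$ (i, k)"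
        using mult_mat_diag_mult_transpose_index[OF U ik] by (simp add: es_def)
    qed (use S U in auto)
    show "length (eigvals_desc S) = n" using len by (simp add: es_def)
  qed
qed

lemma eigvals_desc_antimono:
  assumes "i \<le> j" "j < length (eigvals_desc S)"
  shows "eigvals_desc S ! j \<le> eigvals_desc S ! i"
  using assms unfolding eigvals_desc_def
  by (intro sorted_rev_nth_mono) auto

subsection \<open>Eigenvalue comparison under congruence\<close>

lemma transposed_conj_eq:
  fixes c :: "'a :: comm_semiring_1 vec"
  assumes "G \<in> carrier_mat n n" "D \<in> carrier_mat n n" "c \<in> carrier_vec n"
  shows "c \<bullet> (G\<^sup>T * D * G *\<^sub>v c) = (G *\<^sub>v c) \<bullet> (D *\<^sub>v (G *\<^sub>v c))"
proof -
  have "c \<bullet> (G\<^sup>T * D * G *\<^sub>v c) = c \<bullet> (G\<^sup>T *\<^sub>v (D *\<^sub>v (G *\<^sub>v c)))"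
    using assms by (simp add: assoc_mult_mat_vec[of _ n n _ n])
  also have "\<dots> = (G\<^sup>T *\<^sub>v (D *\<^sub>v (G *\<^sub>v c))) \<bullet> c"
    using assms by (intro comm_scalar_prod[of _ n]) auto
  also have "\<dots> = (D *\<^sub>v (G *\<^sub>v c)) \<bullet> (G *\<^sub>v c)"
    using assms by (intro transpose_vec_mult_scalar[of _ n n]) auto
  also have "\<dots> = (G *\<^sub>v c) \<bullet> (D *\<^sub>v (G *\<^sub>v c))"
    using assms by (intro comm_scalar_prod[of _ n]) auto
  finally show ?thesis .
qed

lemma scalar_prod_self_sum:
  fixes c :: "'a :: comm_semiring_1 vec"
  assumes "c \<in> carrier_vec n"
  shows "c \<bullet> c = (\<Sum>i<n. (c $ i)\<^sup>2)"
  using assms by (simp add: scalar_prod_def power2_eq_square atLeast0LessThan)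

text \<open>The Courant-Fischer dimension count: \<open>j + 1\<close> free coordinates against the \<open>j\<close> equations
  \<open>(G c)\<^sub>i = 0\<close>, \<open>i < j\<close>, made into a square system with one zero row.\<close>

lemma exists_vec_supported_below_image_supported_above:
  fixes G :: "'a :: field mat"
  assumes G: "G \<in> carrier_mat n n" and j: "j < n"
  obtains c where "c \<in> carrier_vec n" "c \<noteq> 0\<^sub>v n"
    "\<And>k. k < n \<Longrightarrow> j < k \<Longrightarrow> c $ k = 0" "\<And>i. i < j \<Longrightarrow> (G *\<^sub>v c) $ i = 0"
proof -
  define M where "M = mat\<^sub>r n n (\<lambda>i. if i = j then 0\<^sub>v n else if i < j then row G i else unit_vec n i)"
  have M: "M \<in> carrier_mat n n" by (simp add: M_def)
  have "det M = 0"
    unfolding M_def using G by (intro det_row_0[OF j, of "\<lambda>i. if i < j then row G i else unit_vec n i"]) auto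
  then obtain c where c: "c \<in> carrier_vec n" "c \<noteq> 0\<^sub>v n" "M *\<^sub>v c = 0\<^sub>v n"
    using det_0_iff_vec_prod_zero_field[OF M] by blast
  have row: "row M i \<bullet> c = 0" if "i < n" for i
    using arg_cong[OF c(3), of "\<lambda>u. u $ i"] that M by simp
  show ?thesis
  proof
    show "c $ k = 0" if "k < n" "j < k" for k
      using row[OF that(1)] that c(1) by (simp add: M_def)
    show "(G *\<^sub>v c) $ i = 0" if "i < j" for i
      using row[of i] that j G by (simp add: M_def)
  qed (use c in auto)
qed

text \<open>The Courant-Fischer comparison after both matrices have been diagonalized;
  \<open>K\<close> stands for a squared norm bound on \<open>G\<close>.\<close>

lemma diag_congruence_eigenvalue_le:
  fixes G :: "real mat"
  assumes G: "G \<in> carrier_mat n n" and ED: "mat_diag n e = G\<^sup>T * mat_diag n d * G"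
    and d0: "\<And>i. i < n \<Longrightarrow> 0 \<le> d i"
    and d: "\<And>i k. i \<le> k \<Longrightarrow> k < n \<Longrightarrow> d k \<le> d i"
    and e: "\<And>i k. i \<le> k \<Longrightarrow> k < n \<Longrightarrow> e k \<le> e i"
    and bound: "\<And>c. c \<in> carrier_vec n \<Longrightarrow> (G *\<^sub>v c) \<bullet> (G *\<^sub>v c) \<le> K * (c \<bullet> c)"
    and j: "j < n"
  shows "e j \<le> K * d j"
proof -
  obtain c where c: "c \<in> carrier_vec n" "c \<noteq> 0\<^sub>v n" "\<And>k. k < n \<Longrightarrow> j < k \<Longrightarrow> c $ k = 0"
      "\<And>i. i < j \<Longrightarrow> (G *\<^sub>v c) $ i = 0"
    using exists_vec_supported_below_image_supported_above[OF G j] by blast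
  define a where "a = G *\<^sub>v c"
  have a: "a \<in> carrier_vec n" using G c(1) by (simp add: a_def)
  have pos: "c \<bullet> c > 0" using conjugate_square_greater_0_vec[OF c(1)] c(2) by simp
  have "e j * (c \<bullet> c) = (\<Sum>i<n. e j * (c $ i)\<^sup>2)"
    by (simp add: scalar_prod_self_sum[OF c(1)] sum_distrib_left)
  \<comment> \<open>The coordinates of \<open>c\<close> beyond \<open>j\<close> vanish, and up to
    \<open>j\<close> the entries of \<open>e\<close> are at least \<open>e j\<close>.\<close>
  also have "\<dots> \<le> (\<Sum>i<n. e i * (c $ i)\<^sup>2)"
  proof (rule sum_mono)
    fix i assume "i \<in> {..<n}"
    then show "e j * (c $ i)\<^sup>2 \<le> e i * (c $ i)\<^sup>2"
      using e[of i j] j c(3)[of i] by (cases "i \<le> j") (auto intro!: mult_right_mono)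
  qed
  also have "\<dots> = c \<bullet> (mat_diag n e *\<^sub>v c)" by (rule quadratic_form_mat_diag[OF c(1), symmetric])
  also have "\<dots> = a \<bullet> (mat_diag n d *\<^sub>v a)"
    unfolding ED a_def using transposed_conj_eq[OF G _ c(1)] by simp
  also have "\<dots> = (\<Sum>i<n. d i * (a $ i)\<^sup>2)" by (rule quadratic_form_mat_diag[OF a])
  \<comment> \<open>The coordinates of \<open>a\<close> before \<open>j\<close> vanish, and from
    \<open>j\<close> on the entries of \<open>d\<close> are at most \<open>d j\<close>.\<close>
  also have "\<dots> \<le> (\<Sum>i<n. d j * (a $ i)\<^sup>2)"
  proof (rule sum_mono)
    fix i assume "i \<in> {..<n}"
    then show "d i * (a $ i)\<^sup>2 \<le> d j * (a $ i)\<^sup>2"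
      using d[of j i] c(4)[of i] by (cases "i < j") (auto simp: a_def intro!: mult_right_mono)
  qed
  also have "\<dots> = d j * (a \<bullet> a)" by (simp add: scalar_prod_self_sum[OF a] sum_distrib_left)
  \<comment> \<open>Positive semidefiniteness enters here: multiplying the norm bound by
    \<open>d j\<close> requires \<open>0 \<le> d j\<close>.\<close>
  also have "\<dots> \<le> d j * (K * (c \<bullet> c))"
    using bound[OF c(1)] d0[OF j] by (auto simp: a_def intro!: mult_left_mono)
  finally show ?thesis using pos by (simp add: mult.assoc[symmetric] mult.commute[of K])
qed

lemma orthogonal_conj_cancel:
  fixes U :: "'a :: field mat"
  assumes U: "U \<in> carrier_mat n n" "U\<^sup>T * U = 1\<^sub>m n" and D: "D \<in> carrier_mat n n"
    and S: "S = U * D * U\<^sup>T"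
  shows "D = U\<^sup>T * S * U"
proof -
  have "U\<^sup>T * S * U = (U\<^sup>T * U) * D * (U\<^sup>T * U)"
    unfolding S using U(1) D by (simp add: assoc_mult_mat[of _ n n _ n _ n])
  then show ?thesis using U D by simp
qed

lemma orthogonal_mat_scalar_prod:
  fixes U :: "'a :: comm_semiring_1 mat"
  assumes "U \<in> carrier_mat n n" "U\<^sup>T * U = 1\<^sub>m n" "x \<in> carrier_vec n" "y \<in> carrier_vec n"
  shows "(U *\<^sub>v x) \<bullet> (U *\<^sub>v y) = x \<bullet> y"
proof -
  have "(U *\<^sub>v x) \<bullet> (U *\<^sub>v y) = (U\<^sup>T *\<^sub>v (U *\<^sub>v x)) \<bullet> y"
    using assms by (intro transpose_vec_mult_scalar[symmetric, of _ n n]) auto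
  also have "U\<^sup>T *\<^sub>v (U *\<^sub>v x) = x"
    using assms by (subst assoc_mult_mat_vec[symmetric, of _ n n _ n]) auto
  finally show ?thesis .
qed

text \<open>The eigenvalue at position \<open>j\<close> is the value of the quadratic form of
  \<open>S\<close> at column \<open>j\<close> of the orthogonal matrix \<open>U\<close>.\<close>

lemma symmetric_psd_eigvals_nonneg:
  fixes S :: "real mat"
  assumes S: "S \<in> carrier_mat n n" "S\<^sup>T = S"
    and psd: "\<And>x. x \<in> carrier_vec n \<Longrightarrow> 0 \<le> x \<bullet> (S *\<^sub>v x)" and j: "j < n"
  shows "0 \<le> eigvals_desc S ! j"
proof -
  obtain U where U: "U \<in> carrier_mat n n" "U\<^sup>T * U = 1\<^sub>m n"
    "S = U * mat_diag n (\<lambda>i. eigvals_desc S ! i) * U\<^sup>T"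
    using symmetric_mat_spectral_desc[OF S] by blast
  define c :: "real vec" where "c = unit_vec n j"
  have c: "c \<in> carrier_vec n" by (simp add: c_def)
  have "c \<bullet> (mat_diag n (\<lambda>i. eigvals_desc S ! i) *\<^sub>v c) = (U *\<^sub>v c) \<bullet> (S *\<^sub>v (U *\<^sub>v c))"
    by (subst orthogonal_conj_cancel[OF U(1,2) mat_diag_dim U(3)], rule transposed_conj_eq[OF U(1) S(1) c])
  also have "\<dots> \<ge> 0" using U(1) c by (intro psd) auto
  finally have "0 \<le> (\<Sum>i<n. eigvals_desc S ! i * (c $ i)\<^sup>2)"
    using quadratic_form_mat_diag[OF c, of "\<lambda>i. eigvals_desc S ! i"] by simp
  also have "\<dots> = (\<Sum>i<n. if i = j then eigvals_desc S ! j else 0)"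
    by (rule sum.cong) (use j in \<open>auto simp: c_def\<close>)
  finally show ?thesis using j by simp
qed

text \<open>The bound concerns the transpose of \<open>A\<close> because the quadratic form of
  \<open>S\<close> at \<open>x\<close> is that of \<open>T\<close> at
  \<open>A\<^sup>T *\<^sub>v x\<close>. Passing to orthonormal eigenbases changes neither the
  spectra nor this bound.\<close>

lemma congruence_eigvals_desc_le:
  fixes A S T :: "real mat"
  assumes A: "A \<in> carrier_mat n n" and T: "T \<in> carrier_mat n n" "T\<^sup>T = T" and S: "S = A * T * A\<^sup>T"
    and psd: "\<And>x. x \<in> carrier_vec n \<Longrightarrow> 0 \<le> x \<bullet> (T *\<^sub>v x)"
    and bound: "\<And>x. x \<in> carrier_vec n \<Longrightarrow> (A\<^sup>T *\<^sub>v x) \<bullet> (A\<^sup>T *\<^sub>v x) \<le> K * (x \<bullet> x)"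
    and j: "j < n"
  shows "eigvals_desc S ! j \<le> K * eigvals_desc T ! j"
proof -
  define d e where "d = (\<lambda>i. eigvals_desc T ! i)" and "e = (\<lambda>i. eigvals_desc S ! i)"
  have Sc: "S \<in> carrier_mat n n" using A T by (simp add: S)
  have St: "S\<^sup>T = S"
    unfolding S using A T by (simp add: transpose_mult[of _ n n _ n] assoc_mult_mat[of _ n n _ n _ n])
  obtain U where U: "U \<in> carrier_mat n n" "U\<^sup>T * U = 1\<^sub>m n" "T = U * mat_diag n d * U\<^sup>T"
      "length (eigvals_desc T) = n"
    using symmetric_mat_spectral_desc[OF T] unfolding d_def by blast
  obtain V where V: "V \<in> carrier_mat n n" "V\<^sup>T * V = 1\<^sub>m n" "S = V * mat_diag n e * V\<^sup>T"
      "length (eigvals_desc S) = n"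
    using symmetric_mat_spectral_desc[OF Sc St] unfolding e_def by blast
  define D where "D = mat_diag n d"
  have D: "D \<in> carrier_mat n n" by (simp add: D_def)
  \<comment> \<open>This is the transpose of \<open>A\<close> read from the eigenbasis of
    \<open>S\<close> to that of \<open>T\<close>.\<close>
  define G where "G = U\<^sup>T * A\<^sup>T * V"
  have G: "G \<in> carrier_mat n n" using U(1) V(1) A by (simp add: G_def)
  have UU: "U * U\<^sup>T = 1\<^sub>m n" using mat_mult_left_right_inverse[OF _ U(1,2)] U(1) by simp
  have "mat_diag n e = V\<^sup>T * (A * T * A\<^sup>T) * V"
    using orthogonal_conj_cancel[OF V(1,2) mat_diag_dim V(3)] S by simp
  also have "\<dots> = G\<^sup>T * D * G"
    unfolding U(3) D_def[symmetric] G_def using U(1) V(1) A D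
    by (simp add: transpose_mult[of _ n n _ n] assoc_mult_mat[of _ n n _ n _ n])
  finally have ED: "mat_diag n e = G\<^sup>T * mat_diag n d * G" by (simp add: D_def)
  have "e j \<le> K * d j"
  proof (rule diag_congruence_eigenvalue_le[OF G ED _ _ _ _ j])
    show "0 \<le> d i" if "i < n" for i
      unfolding d_def by (rule symmetric_psd_eigvals_nonneg[OF T psd that])
    show "d k \<le> d i" if "i \<le> k" "k < n" for i k
      using that U(4) by (auto simp: d_def intro: eigvals_desc_antimono)
    show "e k \<le> e i" if "i \<le> k" "k < n" for i k
      using that V(4) by (auto simp: e_def intro: eigvals_desc_antimono)
    fix c :: "real vec" assume c: "c \<in> carrier_vec n"
    have Vc: "V *\<^sub>v c \<in> carrier_vec n" using V(1) c by simp
    have "G *\<^sub>v c = U\<^sup>T *\<^sub>v (A\<^sup>T *\<^sub>v (V *\<^sub>v c))"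
      unfolding G_def using U(1) V(1) A c by (simp add: assoc_mult_mat_vec[of _ n n _ n])
    then have "(G *\<^sub>v c) \<bullet> (G *\<^sub>v c) = (A\<^sup>T *\<^sub>v (V *\<^sub>v c)) \<bullet> (A\<^sup>T *\<^sub>v (V *\<^sub>v c))"
      using orthogonal_mat_scalar_prod[of "U\<^sup>T" n] U(1) UU A Vc by simp
    also have "\<dots> \<le> K * ((V *\<^sub>v c) \<bullet> (V *\<^sub>v c))" by (rule bound[OF Vc])
    also have "(V *\<^sub>v c) \<bullet> (V *\<^sub>v c) = c \<bullet> c" by (rule orthogonal_mat_scalar_prod[OF V(1,2) c c])
    finally show "(G *\<^sub>v c) \<bullet> (G *\<^sub>v c) \<le> K * (c \<bullet> c)" .
  qed
  then show ?thesis by (simp add: d_def e_def)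
qed

section \<open>Norm bounds for a matrix and its transpose\<close>

lemma scalar_prod_Cauchy_Schwarz:
  fixes x y :: "real vec"
  assumes "x \<in> carrier_vec n" "y \<in> carrier_vec n"
  shows "(x \<bullet> y)\<^sup>2 \<le> (x \<bullet> x) * (y \<bullet> y)"
proof -
  have "\<bar>x \<bullet> y\<bar> \<le> (\<Sum>i<n. \<bar>x $ i\<bar> * \<bar>y $ i\<bar>)"
    using assms by (auto simp: scalar_prod_def atLeast0LessThan abs_mult intro: order.trans[OF sum_abs])
  also have "\<dots> \<le> L2_set (($) x) {..<n} * L2_set (($) y) {..<n}" by (rule L2_set_mult_ineq)
  finally have "\<bar>x \<bullet> y\<bar>\<^sup>2 \<le> (L2_set (($) x) {..<n} * L2_set (($) y) {..<n})\<^sup>2"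
    by (intro power_mono) auto
  then show ?thesis
    using assms by (simp add: power_mult_distrib L2_set_def sum_nonneg scalar_prod_self_sum)
qed

text \<open>Cauchy-Schwarz in each row. The constant is not sharp; it serves to show that the
  supremum defining the operator norm is over a bounded set.\<close>

lemma mult_mat_vec_Frobenius_bound:
  fixes M :: "real mat"
  assumes M: "M \<in> carrier_mat n n" and x: "x \<in> carrier_vec n"
  shows "(M *\<^sub>v x) \<bullet> (M *\<^sub>v x) \<le> (\<Sum>i<n. row M i \<bullet> row M i) * (x \<bullet> x)"
proof -
  have "(M *\<^sub>v x) \<bullet> (M *\<^sub>v x) = (\<Sum>i<n. (row M i \<bullet> x)\<^sup>2)"
    using M x by (subst scalar_prod_self_sum[of _ n]) auto
  also have "\<dots> \<le> (\<Sum>i<n. (row M i \<bullet> row M i) * (x \<bullet> x))"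
    using M x by (intro sum_mono scalar_prod_Cauchy_Schwarz[of _ n]) auto
  finally show ?thesis by (simp add: sum_distrib_right)
qed

text \<open>With \<open>y = M\<^sup>T *\<^sub>v x\<close>, the square of \<open>y\<close> equals
  \<open>x \<bullet> (M *\<^sub>v y)\<close>, and Cauchy-Schwarz reduces the claim to the bound for
  \<open>M\<close>. The operator norm controls \<open>A\<close>, while the eigenvalue comparison
  needs its transpose.\<close>

lemma transpose_mat_bound:
  fixes M :: "real mat"
  assumes M: "M \<in> carrier_mat n n"
    and bound: "\<And>x. x \<in> carrier_vec n \<Longrightarrow> (M *\<^sub>v x) \<bullet> (M *\<^sub>v x) \<le> K * (x \<bullet> x)"
    and K: "0 \<le> K" and x: "x \<in> carrier_vec n"
  shows "(M\<^sup>T *\<^sub>v x) \<bullet> (M\<^sup>T *\<^sub>v x) \<le> K * (x \<bullet> x)"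
proof -
  define y where "y = M\<^sup>T *\<^sub>v x"
  have y: "y \<in> carrier_vec n" and My: "M *\<^sub>v y \<in> carrier_vec n" using M x by (auto simp: y_def)
  have nonneg: "0 \<le> x \<bullet> x" "0 \<le> y \<bullet> y"
    using x y by (auto simp: scalar_prod_self_sum sum_nonneg)
  have "y \<bullet> y = x \<bullet> (M *\<^sub>v y)"
    using transpose_vec_mult_scalar[OF M y x] by (simp add: y_def)
  then have "(y \<bullet> y)\<^sup>2 \<le> (x \<bullet> x) * ((M *\<^sub>v y) \<bullet> (M *\<^sub>v y))"
    using scalar_prod_Cauchy_Schwarz[OF x My] by simp
  also have "\<dots> \<le> (x \<bullet> x) * (K * (y \<bullet> y))"
    using bound[OF y] nonneg by (intro mult_left_mono) auto
  finally have "(y \<bullet> y) * (y \<bullet> y) \<le> (K * (x \<bullet> x)) * (y \<bullet> y)"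
    by (simp add: power2_eq_square algebra_simps)
  \<comment> \<open>The factor \<open>y \<bullet> y\<close> is cancelled; if it is zero, the claim
    is that the right-hand side is nonnegative.\<close>
  then show ?thesis
    using nonneg K by (cases "y \<bullet> y = 0") (auto simp: y_def[symmetric])
qed

subsection \<open>Weighted inner products\<close>

text \<open>A two-sided inverse makes \<open>X\<close> a unit of the matrix ring, so
  \<open>mat_inverse\<close> does return a value; uniqueness of inverses identifies it with
  \<open>Y\<close>.\<close>

lemma minv_eqI:
  assumes X: "X \<in> carrier_mat n n" and Y: "Y \<in> carrier_mat n n" and XY: "X * Y = 1\<^sub>m n" "Y * X = 1\<^sub>m n"
  shows "minv X = Y"
proof -
  have "X \<in> Units (ring_mat TYPE(real) n ())"
    using assms by (auto simp: Units_def ring_mat_simps)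
  then obtain B where B: "mat_inverse X = Some B"
    using mat_inverse(1)[OF X, of "()"] by (cases "mat_inverse X") auto
  from mat_inverse(2)[OF X this] have XB: "X * B = 1\<^sub>m n" "B \<in> carrier_mat n n" by auto
  have "B = (Y * X) * B" using XB XY by simp
  also have "\<dots> = Y * (X * B)" using X Y XB by (intro assoc_mult_mat) auto
  finally have "B = Y" using XB Y by simp
  then show ?thesis by (simp add: minv_def B)
qed

lemma minv_invertible:
  assumes A: "A \<in> carrier_mat n n" and inv: "invertible_mat A"
  shows "minv A \<in> carrier_mat n n" "A * minv A = 1\<^sub>m n" "minv A * A = 1\<^sub>m n"
proof -
  obtain B where AB: "A * B = 1\<^sub>m n" and BA: "B * A = 1\<^sub>m (dim_row B)"
    using inv A unfolding invertible_mat_def inverts_mat_def by auto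
  \<comment> \<open>\<open>invertible_mat\<close> does not state the size of the inverse; it is read
    off from the dimensions of the two products.\<close>
  have "dim_col B = n" using arg_cong[OF AB, of dim_col] by simp
  moreover have "dim_row B = n" using arg_cong[OF BA, of dim_col] A by simp
  ultimately have B: "B \<in> carrier_mat n n" by auto
  have BA': "B * A = 1\<^sub>m n" using BA B by simp
  have "minv A = B" by (rule minv_eqI[OF A B AB BA'])
  then show "minv A \<in> carrier_mat n n" "A * minv A = 1\<^sub>m n" "minv A * A = 1\<^sub>m n"
    using B AB BA' by auto
qed

lemma mat_diag_cong: "(\<And>i. i < n \<Longrightarrow> f i = g i) \<Longrightarrow> mat_diag n f = mat_diag n g"
  by (auto simp: mat_diag_def)

section \<open>Change of coordinates by the square root of the weight matrix\<close>

definition wsqrt :: "nat \<Rightarrow> (nat \<Rightarrow> real) \<Rightarrow> real mat" where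
  "wsqrt n w = mat_diag n (\<lambda>i. sqrt (w i))"

definition winvsqrt :: "nat \<Rightarrow> (nat \<Rightarrow> real) \<Rightarrow> real mat" where
  "winvsqrt n w = mat_diag n (\<lambda>i. 1 / sqrt (w i))"

lemma wsqrt_carrier: "wsqrt n w \<in> carrier_mat n n"
  and winvsqrt_carrier: "winvsqrt n w \<in> carrier_mat n n"
  by (simp_all add: wsqrt_def winvsqrt_def)

text \<open>Conjugation by \<open>W\<^bsup>1/2\<^esup>\<close> turns \<open>\<langle>\<cdot>, \<cdot>\<rangle>\<^sub>W\<close> into the standard inner product and the
  \<open>W\<close>-adjoint into the transpose.\<close>

definition wsymm :: "nat \<Rightarrow> (nat \<Rightarrow> real) \<Rightarrow> real mat \<Rightarrow> real mat" where
  "wsymm n w M = wsqrt n w * M * winvsqrt n w"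

context
  fixes n :: nat and w :: "nat \<Rightarrow> real"
  assumes w: "\<forall>i<n. 0 < w i"
begin

private abbreviation "R \<equiv> wsqrt n w"
private abbreviation "Q \<equiv> winvsqrt n w"

private lemmas RQ = wsqrt_carrier[of n w] winvsqrt_carrier[of n w]

lemma wsqrt_inverse: "R * Q = 1\<^sub>m n" "Q * R = 1\<^sub>m n"
proof -
  have "mat_diag n (\<lambda>i. sqrt (w i) * (1 / sqrt (w i))) = mat_diag n (\<lambda>_. 1)"
    using w by (intro mat_diag_cong) auto
  then show "R * Q = 1\<^sub>m n" "Q * R = 1\<^sub>m n" by (simp_all add: wsqrt_def winvsqrt_def mult.commute)
qed

lemma wsymm_carrier: "M \<in> carrier_mat n n \<Longrightarrow> wsymm n w M \<in> carrier_mat n n"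
  unfolding wsymm_def using RQ by simp

lemma wsymm_mult:
  assumes "M \<in> carrier_mat n n" "L \<in> carrier_mat n n"
  shows "wsymm n w (M * L) = wsymm n w M * wsymm n w L"
proof -
  have "wsymm n w M * wsymm n w L = R * M * (Q * R) * L * Q"
    unfolding wsymm_def using assms RQ
    by (simp add: assoc_mult_mat[of _ n n _ n _ n])
  also have "\<dots> = wsymm n w (M * L)"
    unfolding wsqrt_inverse wsymm_def using assms RQ by (simp add: assoc_mult_mat[of _ n n _ n _ n])
  finally show ?thesis by simp
qed

lemma wsymm_one: "wsymm n w (1\<^sub>m n) = 1\<^sub>m n"
  unfolding wsymm_def using wsqrt_inverse(1) RQ by simp

lemma eigvals_desc_wsymm:
  "M \<in> carrier_mat n n \<Longrightarrow> eigvals_desc (wsymm n w M) = eigvals_desc M"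
  unfolding eigvals_desc_def wsymm_def using wsqrt_inverse RQ
  by (subst char_poly_conj) auto

lemma wadjoint_eq:
  assumes M: "M \<in> carrier_mat n n"
  shows "wadjoint w M = mat_diag n (\<lambda>i. 1 / w i) * M\<^sup>T * mat_diag n w"
proof -
  have "mat_diag n (\<lambda>i. w i * (1 / w i)) = mat_diag n (\<lambda>_. 1)"
    using w by (intro mat_diag_cong) auto
  then have "mat_diag n w * mat_diag n (\<lambda>i. 1 / w i) = 1\<^sub>m n"
      "mat_diag n (\<lambda>i. 1 / w i) * mat_diag n w = 1\<^sub>m n"
    by (simp_all add: mult.commute)
  then have "minv (mat_diag n w) = mat_diag n (\<lambda>i. 1 / w i)"
    by (rule minv_eqI[OF mat_diag_dim mat_diag_dim])
  then show ?thesis using M by (simp add: wadjoint_def)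
qed

lemma wadjoint_carrier: "M \<in> carrier_mat n n \<Longrightarrow> wadjoint w M \<in> carrier_mat n n"
  unfolding wadjoint_eq by (meson mat_diag_dim mult_carrier_mat transpose_carrier_mat)

text \<open>With \<open>W\<close> the weight matrix, \<open>R\<close> times the inverse of
  \<open>W\<close> is \<open>Q\<close>, and \<open>W * Q = R\<close>. What remains is
  \<open>Q * M\<^sup>T * R\<close>, the transpose of \<open>R * M * Q\<close> because
  \<open>R\<close> and \<open>Q\<close> are diagonal.\<close>

lemma wsymm_wadjoint:
  assumes M: "M \<in> carrier_mat n n"
  shows "wsymm n w (wadjoint w M) = (wsymm n w M)\<^sup>T"
proof -
  define W W' where "W = mat_diag n w" and "W' = mat_diag n (\<lambda>i. 1 / w i)"
  have W: "W \<in> carrier_mat n n" "W' \<in> carrier_mat n n" by (simp_all add: W_def W'_def)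
  have adj: "wadjoint w M = W' * M\<^sup>T * W"
    using wadjoint_eq[OF M] by (simp only: W_def W'_def)
  have "sqrt (w i) * (1 / w i) = 1 / sqrt (w i)" "w i * (1 / sqrt (w i)) = sqrt (w i)" if "i < n" for i
    using w that real_div_sqrt[of "w i"] by (simp_all add: less_imp_le divide_simps)
  then have "R * W' = Q" "W * Q = R"
    by (auto simp: wsqrt_def winvsqrt_def W_def W'_def simp del: times_divide_eq_right intro!: mat_diag_cong)
  moreover have "wsymm n w (wadjoint w M) = (R * W') * M\<^sup>T * (W * Q)"
    unfolding wsymm_def adj using M W RQ by (simp add: assoc_mult_mat[of _ n n _ n _ n])
  moreover have "R\<^sup>T = R" "Q\<^sup>T = Q"
    by (auto simp: wsqrt_def winvsqrt_def mat_diag_def intro!: eq_matI)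
  ultimately show ?thesis
    unfolding wsymm_def using M RQ
    by (simp add: assoc_mult_mat[of _ n n _ n _ n] transpose_mult[of _ n n _ n])
qed

lemma winner_eq_scalar_prod:
  assumes "u \<in> carrier_vec n" "v \<in> carrier_vec n"
  shows "winner w u v = (R *\<^sub>v u) \<bullet> (R *\<^sub>v v)"
proof -
  have idx: "(R *\<^sub>v x) $ i = sqrt (w i) * x $ i" if "i < n" "x \<in> carrier_vec n" for i x
    using that by (simp add: wsqrt_def mat_diag_def scalar_prod_def) (subst sum.remove[of _ i], auto)
  have "(R *\<^sub>v u) \<bullet> (R *\<^sub>v v) = (\<Sum>i<n. (R *\<^sub>v u) $ i * (R *\<^sub>v v) $ i)"
    by (simp add: scalar_prod_def atLeast0LessThan wsqrt_def mat_diag_def)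
  also have "\<dots> = (\<Sum>i<n. w i * u $ i * v $ i)"
    using w assms by (intro sum.cong) (auto simp: idx simp del: index_mult_mat_vec)
  finally show ?thesis using assms by (simp add: winner_def)
qed

lemma wnorm_eq: "u \<in> carrier_vec n \<Longrightarrow> wnorm w u = sqrt ((R *\<^sub>v u) \<bullet> (R *\<^sub>v u))"
  by (simp add: wnorm_def winner_eq_scalar_prod)

lemma wsymm_mult_vec:
  assumes "M \<in> carrier_mat n n" "u \<in> carrier_vec n"
  shows "wsymm n w M *\<^sub>v (R *\<^sub>v u) = R *\<^sub>v (M *\<^sub>v u)"
proof -
  have "wsymm n w M *\<^sub>v (R *\<^sub>v u) = R *\<^sub>v (M *\<^sub>v ((Q * R) *\<^sub>v u))"
    unfolding wsymm_def using assms RQ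
    by (simp add: assoc_mult_mat_vec[of _ n n _ n] assoc_mult_mat[of _ n n _ n _ n])
  then show ?thesis using assms wsqrt_inverse(2) by simp
qed

lemma wsqrt_surj:
  assumes "x \<in> carrier_vec n"
  obtains u where "u \<in> carrier_vec n" "x = R *\<^sub>v u"
proof
  show "Q *\<^sub>v x \<in> carrier_vec n" using assms RQ by simp
  show "x = R *\<^sub>v (Q *\<^sub>v x)"
    using assms wsqrt_inverse(1) RQ by (subst assoc_mult_mat_vec[symmetric, of _ n n _ n]) auto
qed

section \<open>The weighted operator norm\<close>

text \<open>The supremum bounds its members only once the quotients are known to be bounded above;
  the Frobenius norm of the symmetrized matrix provides this.\<close>

lemma wnorm_mult_mat_vec_le:
  assumes M: "M \<in> carrier_mat n n" and u: "u \<in> carrier_vec n"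
  shows "wnorm w (M *\<^sub>v u) \<le> wopnorm w M * wnorm w u"
proof -
  define F where "F = (\<Sum>i<n. row (wsymm n w M) i \<bullet> row (wsymm n w M) i)"
  have Rc: "R *\<^sub>v v \<in> carrier_vec n" if "v \<in> carrier_vec n" for v :: "real vec"
    using that RQ by simp
  have pos: "0 < wnorm w v" if v: "v \<in> carrier_vec n" "v \<noteq> 0\<^sub>v n" for v :: "real vec"
  proof -
    have "R *\<^sub>v v \<noteq> 0\<^sub>v n"
    proof
      assume "R *\<^sub>v v = 0\<^sub>v n"
      then have "(Q * R) *\<^sub>v v = Q *\<^sub>v 0\<^sub>v n"
        using v RQ by (subst assoc_mult_mat_vec[of _ n n _ n]) auto
      also have "\<dots> = 0\<^sub>v n" by (intro eq_vecI) (auto simp: winvsqrt_def mat_diag_def)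
      finally show False using v wsqrt_inverse(2) by simp
    qed
    then show ?thesis using conjugate_square_greater_0_vec[OF Rc[OF v(1)]] v by (simp add: wnorm_eq)
  qed
  have bdd: "bdd_above ((\<lambda>u. wnorm w (M *\<^sub>v u) / wnorm w u) ` (carrier_vec n - {0\<^sub>v n}))"
  proof (rule bdd_aboveI2)
    fix v :: "real vec" assume "v \<in> carrier_vec n - {0\<^sub>v n}"
    then have v: "v \<in> carrier_vec n" "v \<noteq> 0\<^sub>v n" by auto
    have "wnorm w (M *\<^sub>v v) \<le> sqrt (F * ((R *\<^sub>v v) \<bullet> (R *\<^sub>v v)))"
      using mult_mat_vec_Frobenius_bound[OF wsymm_carrier[OF M] Rc[OF v(1)]] M v(1)
      by (simp add: wnorm_eq wsymm_mult_vec F_def)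
    also have "\<dots> = sqrt F * wnorm w v" using v by (simp add: wnorm_eq real_sqrt_mult)
    finally show "wnorm w (M *\<^sub>v v) / wnorm w v \<le> sqrt F" using pos[OF v] by (simp add: divide_le_eq)
  qed
  show ?thesis
  proof (cases "u = 0\<^sub>v n")
    \<comment> \<open>The zero vector lies outside the index set of the supremum; here both sides
      are zero.\<close>
    case True
    have "M *\<^sub>v 0\<^sub>v n = 0\<^sub>v n" using M by (intro eq_vecI) auto
    with True show ?thesis by (simp add: wnorm_def winner_def)
  next
    case False
    have "wnorm w (M *\<^sub>v u) / wnorm w u \<le> wopnorm w M"
      using M u False bdd by (auto simp: wopnorm_def intro!: cSUP_upper)
    then show ?thesis using pos[OF u False] by (simp add: divide_le_eq)
  qed
qed

text \<open>Positive dimension supplies a nonzero test vector. The sign is what allows upper bounds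
  on the norm to be squared.\<close>

lemma wopnorm_nonneg:
  assumes M: "M \<in> carrier_mat n n" and n: "0 < n"
  shows "0 \<le> wopnorm w M"
proof -
  define u :: "real vec" where "u = unit_vec n 0"
  have "winner w u u = (\<Sum>i<n. if i = 0 then w 0 else 0)"
    unfolding winner_def by (rule sum.cong) (auto simp: u_def)
  then have "wnorm w u > 0" using n w by (simp add: wnorm_def)
  moreover have "0 \<le> wnorm w (M *\<^sub>v u)"
    using M w by (auto simp: wnorm_def winner_def mult.assoc less_imp_le intro!: sum_nonneg)
  moreover have "wnorm w (M *\<^sub>v u) \<le> wopnorm w M * wnorm w u"
    by (rule wnorm_mult_mat_vec_le[OF M]) (simp add: u_def)
  ultimately show ?thesis by (smt (verit) mult_less_0_iff)
qed

text \<open>Every vector is \<open>R *\<^sub>v u\<close> for some \<open>u\<close>, so the weighted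
  norm of \<open>M\<close> bounds \<open>wsymm n w M\<close> in the standard norm, and the bound
  passes to the transpose.\<close>

lemma wsymm_transpose_bound:
  assumes M: "M \<in> carrier_mat n n" and x: "x \<in> carrier_vec n"
  shows "((wsymm n w M)\<^sup>T *\<^sub>v x) \<bullet> ((wsymm n w M)\<^sup>T *\<^sub>v x) \<le> (wopnorm w M)\<^sup>2 * (x \<bullet> x)"
proof (rule transpose_mat_bound[OF wsymm_carrier[OF M] _ _ x])
  fix y :: "real vec" assume "y \<in> carrier_vec n"
  then obtain u where u: "u \<in> carrier_vec n" "y = R *\<^sub>v u" by (rule wsqrt_surj)
  have nonneg: "0 \<le> z \<bullet> z" for z :: "real vec"
    using scalar_prod_self_sum[of z "dim_vec z"] by (simp add: sum_nonneg)
  have "(wnorm w (M *\<^sub>v u))\<^sup>2 \<le> (wopnorm w M * wnorm w u)\<^sup>2"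
    using M u nonneg by (intro power_mono wnorm_mult_mat_vec_le) (auto simp: wnorm_eq)
  then show "(wsymm n w M *\<^sub>v y) \<bullet> (wsymm n w M *\<^sub>v y) \<le> (wopnorm w M)\<^sup>2 * (y \<bullet> y)"
    using M u nonneg by (simp add: wnorm_eq wsymm_mult_vec power_mult_distrib)
qed simp

section \<open>Eigenvalue bounds in the weighted setting\<close>

text \<open>Both inequalities are instances of one upper bound, applied to \<open>A\<close> and then
  to its inverse. The second keeps the norm of \<open>minv A\<close> on the side of
  \<open>B\<close>, which avoids division; positions count from 0.\<close>

lemma wcongruence_eigvals_desc:
  assumes n: "0 < n" and A: "A \<in> carrier_mat n n" and inv: "invertible_mat A"
    and T: "T \<in> carrier_mat n n" and self: "wself_adjoint w T" and psd: "wpos_semidef w T"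
    and B: "B = A * T * wadjoint w A"
  shows "length (eigvals_desc T) = n" "length (eigvals_desc B) = n"
    and "j < n \<Longrightarrow> 0 \<le> eigvals_desc T ! j"
    and "j < n \<Longrightarrow> 0 \<le> eigvals_desc B ! j"
    and "j < n \<Longrightarrow> eigvals_desc B ! j \<le> (wopnorm w A)\<^sup>2 * eigvals_desc T ! j"
    and "j < n \<Longrightarrow> eigvals_desc T ! j \<le> (wopnorm w (minv A))\<^sup>2 * eigvals_desc B ! j"
proof -
  define T' A' B' C' where "T' = wsymm n w T" and "A' = wsymm n w A" and "B' = wsymm n w B"
    and "C' = wsymm n w (minv A)"
  note minv = minv_invertible[OF A inv]
  have adj: "wadjoint w A \<in> carrier_mat n n"
    using A by (rule wadjoint_carrier)
  have Bc: "B \<in> carrier_mat n n" using A T adj by (simp add: B)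
  have T': "T' \<in> carrier_mat n n" and A': "A' \<in> carrier_mat n n" and B': "B' \<in> carrier_mat n n"
    and C': "C' \<in> carrier_mat n n"
    using A T Bc minv(1) by (auto simp: T'_def A'_def B'_def C'_def wsymm_carrier)
  have sym: "T'\<^sup>T = T'"
    using wsymm_wadjoint[OF T] self by (simp add: T'_def wself_adjoint_def)
  have BA: "B' = A' * T' * A'\<^sup>T"
    unfolding B'_def B A'_def T'_def
    using A T adj wsymm_carrier[OF A] wsymm_carrier[OF T]
    by (simp add: wsymm_mult wsymm_wadjoint assoc_mult_mat[of _ n n _ n _ n])
  have symB: "B'\<^sup>T = B'"
    unfolding BA using A' T' sym by (simp add: transpose_mult[of _ n n _ n] assoc_mult_mat[of _ n n _ n _ n])
  have CA: "C' * A' = 1\<^sub>m n"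
    using wsymm_mult[OF minv(1) A] by (simp add: minv(3) wsymm_one A'_def C'_def)
  \<comment> \<open>Undoing the congruence exchanges the roles: \<open>T'\<close> is the congruence
    of \<open>B'\<close> by \<open>C'\<close>.\<close>
  have "C' * B' * C'\<^sup>T = (C' * A') * T' * (C' * A')\<^sup>T"
    unfolding BA using A' T' C' by (simp add: transpose_mult[of _ n n _ n] assoc_mult_mat[of _ n n _ n _ n])
  then have TB: "T' = C' * B' * C'\<^sup>T" using T' by (simp add: CA)
  have psdT: "0 \<le> x \<bullet> (T' *\<^sub>v x)" if x: "x \<in> carrier_vec n" for x
  proof -
    obtain u where u: "u \<in> carrier_vec n" "x = R *\<^sub>v u" by (rule wsqrt_surj[OF x])
    have "0 \<le> winner w u (T *\<^sub>v u)" using psd T u by (simp add: wpos_semidef_def)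
    then show ?thesis using T u by (simp add: winner_eq_scalar_prod wsymm_mult_vec T'_def)
  qed
  have psdB: "0 \<le> x \<bullet> (B' *\<^sub>v x)" if x: "x \<in> carrier_vec n" for x
    unfolding BA using transposed_conj_eq[of "A'\<^sup>T" n T' x] A' T' x psdT[of "A'\<^sup>T *\<^sub>v x"] by simp
  have eT: "eigvals_desc T' = eigvals_desc T" and eB: "eigvals_desc B' = eigvals_desc B"
    using T Bc by (simp_all add: T'_def B'_def eigvals_desc_wsymm)
  show "length (eigvals_desc T) = n"
    using symmetric_mat_spectral_desc[OF T' sym] unfolding eT by blast
  show "length (eigvals_desc B) = n"
    using symmetric_mat_spectral_desc[OF B' symB] unfolding eB by blast
  assume j: "j < n"
  show "0 \<le> eigvals_desc T ! j"
    using symmetric_psd_eigvals_nonneg[OF T' sym psdT j] by (simp add: eT)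
  show "0 \<le> eigvals_desc B ! j"
    using symmetric_psd_eigvals_nonneg[OF B' symB psdB j] by (simp add: eB)
  show "eigvals_desc B ! j \<le> (wopnorm w A)\<^sup>2 * eigvals_desc T ! j"
    using congruence_eigvals_desc_le[OF A' T' sym BA psdT _ j] wsymm_transpose_bound[OF A]
    unfolding eT eB A'_def by blast
  show "eigvals_desc T ! j \<le> (wopnorm w (minv A))\<^sup>2 * eigvals_desc B ! j"
    using congruence_eigvals_desc_le[OF C' B' symB TB psdB _ j] wsymm_transpose_bound[OF minv(1)]
    unfolding eT eB C'_def by blast
qed

end

text \<open>Puts the lower bound into the form with the inverse norm. For \<open>k = 0\<close> the
  inverse is 0 by convention, and the claim is \<open>0 \<le> m\<close>.\<close>

lemma inverse_square_mult_le:
  fixes k s m :: real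
  assumes "s \<le> k\<^sup>2 * m" "0 \<le> m"
  shows "(inverse k)\<^sup>2 * s \<le> m"
proof (cases "k = 0")
  case False
  then show ?thesis using assms by (simp add: power_inverse field_simps)
qed (use assms in simp)

theorem proposition3p1:
  shows
   "(\<forall>(N::nat) (w :: nat \<Rightarrow> real) (A :: real mat) (T :: real mat) (B :: real mat).
       1 \<le> N \<longrightarrow> (\<forall>i<N. 0 < w i) \<longrightarrow>
       A \<in> carrier_mat N N \<longrightarrow> invertible_mat A \<longrightarrow>
       T \<in> carrier_mat N N \<longrightarrow> wself_adjoint w T \<longrightarrow> wpos_semidef w T \<longrightarrow>
       B = A * T * wadjoint w A \<longrightarrow>
         length (eigvals_desc T) = N \<and> length (eigvals_desc B) = N \<and>
         (\<forall>j\<in>{1..N}.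
            0 \<le> eigval_desc T j \<and> 0 \<le> eigval_desc B j \<and>
            (inverse (wopnorm w (minv A)))^2 * eigval_desc T j \<le> eigval_desc B j \<and>
            eigval_desc B j \<le> (wopnorm w A)^2 * eigval_desc T j))
    \<and>
    (\<forall>(I :: nat set) (w :: nat \<Rightarrow> nat \<Rightarrow> real) (A :: nat \<Rightarrow> real mat)
        (T :: nat \<Rightarrow> real mat) (B :: nat \<Rightarrow> real mat) (c :: real) (C :: real).
       0 < c \<longrightarrow> c \<le> C \<longrightarrow>
       (\<forall>N\<in>I. 1 \<le> N \<and> (\<forall>i<N. 0 < w N i) \<and>
          A N \<in> carrier_mat N N \<and> invertible_mat (A N) \<and>
          T N \<in> carrier_mat N N \<and> wself_adjoint (w N) (T N) \<and> wpos_semidef (w N) (T N) \<and>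
          B N = A N * T N * wadjoint (w N) (A N) \<and>
          wopnorm (w N) (A N) \<le> C \<and> wopnorm (w N) (minv (A N)) \<le> inverse c) \<longrightarrow>
       (\<forall>N\<in>I. \<forall>j\<in>{1..N}.
          c^2 * eigval_desc (T N) j \<le> eigval_desc (B N) j \<and>
          eigval_desc (B N) j \<le> C^2 * eigval_desc (T N) j))"
proof (intro conjI allI impI, goal_cases)
  case (1 N w A T B)
  then show ?case using wcongruence_eigvals_desc(1)[of N w A T B] by simp
next
  case (2 N w A T B)
  then show ?case using wcongruence_eigvals_desc(2)[of N w A T B] by simp
next
  case (3 N w A T B)
  show ?case
  proof
    fix j assume "j \<in> {1..N}"
    \<comment> \<open>Eigenvalues are counted from 1, list positions from 0.\<close>
    then have j: "j - 1 < N" by auto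
    have N: "0 < N" using 3(1) by simp
    note * = wcongruence_eigvals_desc[OF 3(2) N 3(3-8)]
    show "0 \<le> eigval_desc T j \<and> 0 \<le> eigval_desc B j \<and>
        (inverse (wopnorm w (minv A)))\<^sup>2 * eigval_desc T j \<le> eigval_desc B j \<and>
        eigval_desc B j \<le> (wopnorm w A)\<^sup>2 * eigval_desc T j"
      unfolding eigval_desc_def
      using *(3-6)[OF j] by (auto intro!: inverse_square_mult_le)
  qed
next
  case (4 I w A T B c C)
  show ?case
  proof (intro ballI)
    fix N j assume N: "N \<in> I" and "j \<in> {1..N}"
    then have j: "j - 1 < N" "0 < N" by auto
    have w: "\<forall>i<N. 0 < w N i" and A: "A N \<in> carrier_mat N N" "invertible_mat (A N)"
      and T: "T N \<in> carrier_mat N N" "wself_adjoint (w N) (T N)" "wpos_semidef (w N) (T N)"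
      and B: "B N = A N * T N * wadjoint (w N) (A N)"
      and C: "wopnorm (w N) (A N) \<le> C" and c: "wopnorm (w N) (minv (A N)) \<le> inverse c"
      using 4(3) N by auto
    note * = wcongruence_eigvals_desc[OF w j(2) A T B]
    have "(wopnorm (w N) (A N))\<^sup>2 \<le> C\<^sup>2"
      using C wopnorm_nonneg[OF w A(1) j(2)] by (rule power_mono)
    then have upper: "eigval_desc (B N) j \<le> C\<^sup>2 * eigval_desc (T N) j"
      unfolding eigval_desc_def using *(3,5)[OF j(1)] by (meson mult_right_mono order.trans)
    have "(wopnorm (w N) (minv (A N)))\<^sup>2 \<le> (inverse c)\<^sup>2"
      using c wopnorm_nonneg[OF w minv_invertible(1)[OF A] j(2)] by (rule power_mono)
    then have "eigval_desc (T N) j \<le> (inverse c)\<^sup>2 * eigval_desc (B N) j"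
      unfolding eigval_desc_def using *(4,6)[OF j(1)] by (meson mult_right_mono order.trans)
    \<comment> \<open>Taking \<open>k = inverse c\<close> leaves \<open>c\<close> itself after the
      double inverse.\<close>
    then have "(inverse (inverse c))\<^sup>2 * eigval_desc (T N) j \<le> eigval_desc (B N) j"
      using *(4)[OF j(1)] by (intro inverse_square_mult_le) (simp_all add: eigval_desc_def)
    with upper show "c\<^sup>2 * eigval_desc (T N) j \<le> eigval_desc (B N) j \<and>
        eigval_desc (B N) j \<le> C\<^sup>2 * eigval_desc (T N) j" by simp
  qed
qed

end
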